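(* Let $n\ge1$ and $\epsilon=\frac{X_n+1}{X_n-1}$. Let $l,m$ be integers with $m\ge1$, $\gcd(l,m)=1$ and $0<|l/m|<1$. Then $\epsilon^{l/m}\notin RE_n^+$; that is, there is no $\delta\in RE_n^+$ with $\delta^m=\epsilon^l$.
   Context: $X_j=2\cos(2\pi/2^{j+2})$ for $j\ge0$, $\mathbb{B}_j=\mathbb{Q}(X_j)$ (totally real, ring of integers $\mathbb{Z}[X_j]$), $G_j=\mathrm{Gal}(\mathbb{B}_j/\mathbb{Q})$ cyclic of order $2^j$ generated by $\sigma$, $E_j$ the unit group of $\mathbb{Z}[X_j]$, $N_{n/n-1}:E_n\to E_{n-1}$, $x\mapsto x\sigma^{2^{n-1}}(x)$ the relative norm, and $RE_n^+=\ker N_{n/n-1}$. The unit $\epsilon=\frac{X_n+1}{X_n-1}$ lies in $RE_n^+$. *)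

theory Defs
  imports Complex_Main "HOL-Algebra.Algebra" "HOL-Algebra.Algebraic_Closure_Type"
begin

abbreviation real_field :: "real ring" where
  "real_field \<equiv> ring_of_type_algebra"

definition cosX :: "nat \<Rightarrow> real" where
  "cosX j = 2 * cos (2 * pi / 2 ^ (j + 2))"

text \<open>The subfield of the reals generated by \<open>cosX j\<close>, which is \<open>\<rat>(cosX j)\<close>
  since every subfield of the reals contains the rationals.\<close>

definition B :: "nat \<Rightarrow> real ring" where
  "B j = real_field\<lparr>carrier := generate_field real_field {cosX j}\<rparr>"

text \<open>The subring of the reals generated by \<open>cosX j\<close>, which is \<open>\<int>[cosX j]\<close>.\<close>

definition ZX :: "nat \<Rightarrow> real ring" where
  "ZX j = real_field\<lparr>carrier := generate_ring real_field {cosX j}\<rparr>"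

definition E :: "nat \<Rightarrow> real monoid" where
  "E j = units_of (ZX j)"

text \<open>Automorphisms of \<open>L\<close> fixing \<open>K\<close> pointwise, under composition. As in
  \<^const>\<open>BijGroup\<close>, only extensional functions are taken, so that an automorphism is
  determined by its values on the carrier.\<close>

definition Galois_group :: "('a, 'b) ring_scheme \<Rightarrow> 'a set \<Rightarrow> ('a \<Rightarrow> 'a) monoid" where
  "Galois_group L K = (BijGroup (carrier L))
     \<lparr>carrier := {f \<in> extensional (carrier L). f \<in> ring_iso L L \<and> (\<forall>x\<in>K. f x = x)}\<rparr>"

definition G :: "nat \<Rightarrow> (real \<Rightarrow> real) monoid" where
  "G j = Galois_group (B j) \<rat>"

definition rel_norm :: "nat \<Rightarrow> (real \<Rightarrow> real) \<Rightarrow> real \<Rightarrow> real" where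
  "rel_norm n \<sigma> x = x * (\<sigma> [^]\<^bsub>G n\<^esub> ((2::nat) ^ (n - 1))) x"

text \<open>Here \<open>\<sigma>\<close> is meant to be a generator of \<open>G n\<close>, and \<open>n \<ge> 1\<close>.\<close>

definition RE_plus :: "nat \<Rightarrow> (real \<Rightarrow> real) \<Rightarrow> real set" where
  "RE_plus n \<sigma> = kernel (E n) (E (n - 1)) (rel_norm n \<sigma>)"

definition eps :: "nat \<Rightarrow> real" where
  "eps n = (cosX n + 1) / (cosX n - 1)"

end

theory Submission
  imports Defs
begin

text \<open>
  Write \<open>X\<close> for \<open>cosX n\<close>. Since \<open>X\<^sub>j\<^sup>2 = X\<^sub>j\<^sub>-\<^sub>1 + 2\<close>, the automorphism
  \<open>\<sigma>\<close> to the power \<open>2\<^sup>n\<^sup>-\<^sup>1\<close> maps \<open>X\<close> to \<open>\<plusminus>X\<close>. If it fixes \<open>X\<close> then \<open>\<delta>\<^sup>2 = 1\<close>, which is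
  absurd. Otherwise \<open>\<delta> = f(X)\<close> with \<open>f\<close> an integer polynomial and \<open>f(X) f(-X) = 1\<close>, and by
  Bezout we may assume \<open>l = 1\<close> and \<open>m \<ge> 2\<close>. Write \<open>f(x) - f(-x) = 2 x b(x)\<close>. At each conjugate
  \<open>x\<close> of \<open>X\<close>, the numbers \<open>d = f(x)\<close> and \<open>e = (x + 1)/(x - 1) = d\<^sup>m\<close> satisfy
  \<open>2 |d - 1/d| < |e - 1/e|\<close>, that is, \<open>|(x\<^sup>2 - 1) b(x)| < 1\<close>. The norm of the algebraic integer
  \<open>(X\<^sup>2 - 1) b(X)\<close> is therefore an integer of absolute value below \<open>1\<close>, so \<open>b(X) = 0\<close> and
  \<open>\<delta>\<^sup>2 = 1\<close>, a contradiction.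
\<close>

section \<open>Integer polynomials as real functions\<close>

text \<open>With polynomials taken as functions, substitution is plain application, and the rules
  match the way \<open>ZX n\<close> is generated from \<open>cosX n\<close>.\<close>

inductive int_poly_fun :: "(real \<Rightarrow> real) \<Rightarrow> bool" where
  const: "int_poly_fun (\<lambda>_. of_int k)"
| ident: "int_poly_fun (\<lambda>x. x)"
| add: "int_poly_fun f \<Longrightarrow> int_poly_fun g \<Longrightarrow> int_poly_fun (\<lambda>x. f x + g x)"
| mult: "int_poly_fun f \<Longrightarrow> int_poly_fun g \<Longrightarrow> int_poly_fun (\<lambda>x. f x * g x)"

lemma int_poly_fun_0 [intro]: "int_poly_fun (\<lambda>_. 0)"
  and int_poly_fun_1 [intro]: "int_poly_fun (\<lambda>_. 1)"
  and int_poly_fun_2 [intro]: "int_poly_fun (\<lambda>_. 2)"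
  using int_poly_fun.const[of 0] int_poly_fun.const[of 1] int_poly_fun.const[of 2] by simp_all

declare int_poly_fun.intros [intro]

lemma int_poly_fun_uminus [intro]:
  assumes "int_poly_fun f"
  shows "int_poly_fun (\<lambda>x. - f x)"
  using int_poly_fun.mult[OF int_poly_fun.const[of "-1"] assms] by simp

lemma int_poly_fun_diff [intro]:
  assumes "int_poly_fun f" "int_poly_fun g"
  shows "int_poly_fun (\<lambda>x. f x - g x)"
  using int_poly_fun.add[OF assms(1) int_poly_fun_uminus[OF assms(2)]] by simp

lemma int_poly_fun_power [intro]:
  assumes "int_poly_fun f"
  shows "int_poly_fun (\<lambda>x. f x ^ k)"
  by (induction k) (use assms in auto)

lemmas int_poly_fun_intros =
  int_poly_fun.ident int_poly_fun_0 int_poly_fun_1 int_poly_fun_2 int_poly_fun.add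
  int_poly_fun.mult int_poly_fun_diff int_poly_fun_power

lemma int_poly_fun_compose:
  assumes "int_poly_fun f" "int_poly_fun g"
  shows "int_poly_fun (\<lambda>x. f (g x))"
  using assms by (induction rule: int_poly_fun.induct) auto

text \<open>This splits f into its even and odd parts. The argument is x^2 - 2 rather than x^2
  because X_j^2 - 2 = X_(j-1): at x = X_j the values of \<open>a\<close> and \<open>b\<close> lie
  one level lower in the tower.\<close>

lemma int_poly_fun_decompose:
  assumes "int_poly_fun f"
  obtains a b where "int_poly_fun a" "int_poly_fun b"
    "\<And>x. f x = a (x\<^sup>2 - 2) + x * b (x\<^sup>2 - 2)"
proof -
  from assms have "\<exists>a b. int_poly_fun a \<and> int_poly_fun b \<and>
    (\<forall>x. f x = a (x\<^sup>2 - 2) + x * b (x\<^sup>2 - 2))"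
  proof (induction rule: int_poly_fun.induct)
    case (const k)
    show ?case
      by (rule exI[of _ "\<lambda>_. of_int k"], rule exI[of _ "\<lambda>_. 0"]) auto
  next
    case ident
    show ?case
      by (rule exI[of _ "\<lambda>_. 0"], rule exI[of _ "\<lambda>_. 1"]) auto
  next
    case (add f g)
    then obtain a b c d where abcd: "int_poly_fun a" "int_poly_fun b" "int_poly_fun c" "int_poly_fun d"
      "\<And>x. f x = a (x\<^sup>2 - 2) + x * b (x\<^sup>2 - 2)" "\<And>x. g x = c (x\<^sup>2 - 2) + x * d (x\<^sup>2 - 2)"
      by blast
    show ?case
      by (rule exI[of _ "\<lambda>x. a x + c x"], rule exI[of _ "\<lambda>x. b x + d x"])
        (intro conjI int_poly_fun_intros abcd(1-4) allI; simp add: abcd(5,6) algebra_simps)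
  next
    case (mult f g)
    then obtain a b c d where abcd: "int_poly_fun a" "int_poly_fun b" "int_poly_fun c" "int_poly_fun d"
      "\<And>x. f x = a (x\<^sup>2 - 2) + x * b (x\<^sup>2 - 2)" "\<And>x. g x = c (x\<^sup>2 - 2) + x * d (x\<^sup>2 - 2)"
      by blast
    \<comment> \<open>With y = x^2 - 2, the product of the two odd parts is x^2 b(y) d(y) = (y + 2)
      b(y) d(y), which joins the even part.\<close>
    show ?case
      by (rule exI[of _ "\<lambda>x. a x * c x + (x + 2) * (b x * d x)"],
          rule exI[of _ "\<lambda>x. a x * d x + b x * c x"])
        (intro conjI int_poly_fun_intros abcd(1-4) allI; simp add: abcd(5,6) algebra_simps
          power2_eq_square)
  qed
  then show ?thesis using that by blast
qed

section \<open>Conjugates of X_n and norms\<close>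

text \<open>Each step adjoins both roots x of x^2 - 2 = y, the relation that links consecutive
  levels of the tower. Products over this set play the role of norms down to the rationals.\<close>

fun conjugates :: "nat \<Rightarrow> real set" where
  "conjugates 0 = {0}"
| "conjugates (Suc n) =
     (\<lambda>y. sqrt (y + 2)) ` conjugates n \<union> (\<lambda>y. - sqrt (y + 2)) ` conjugates n"

lemma finite_conjugates [simp]: "finite (conjugates n)"
  by (induction n) auto

text \<open>The lower bound makes y + 2 positive, so that \<open>sqrt\<close> yields a true nonzero
  root. The upper bound is what gives -sqrt(y + 2) > -2 at the next level.\<close>

lemma conjugates_bounds: "x \<in> conjugates n \<Longrightarrow> - 2 < x \<and> x < 2"
proof (induction n arbitrary: x)
  case (Suc n)
  then obtain y where y: "y \<in> conjugates n" "x = sqrt (y + 2) \<or> x = - sqrt (y + 2)" by auto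
  have "0 < y + 2" "y + 2 < 2\<^sup>2" using Suc.IH[OF y(1)] by auto
  then have "0 < sqrt (y + 2)" "sqrt (y + 2) < 2" by (simp_all add: real_less_lsqrt)
  then show ?case using y(2) by (elim disjE; linarith)
qed auto

lemma conjugates_Suc_sq:
  assumes "x \<in> conjugates (Suc n)"
  shows "x\<^sup>2 - 2 \<in> conjugates n" "x \<noteq> 0"
  using assms conjugates_bounds[of _ n] by (force simp: less_imp_le)+

lemma uminus_conjugates_Suc: "x \<in> conjugates (Suc n) \<Longrightarrow> - x \<in> conjugates (Suc n)"
  by auto

declare conjugates.simps(2) [simp del]

text \<open>Transitivity of the norm: the product is taken fibre by fibre. The two branches are
  disjoint because they differ in sign.\<close>

lemma prod_conjugates_Suc:
  fixes f :: "real \<Rightarrow> real"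
  shows "prod f (conjugates (Suc n)) =
    (\<Prod>y\<in>conjugates n. f (sqrt (y + 2)) * f (- sqrt (y + 2)))"
proof -
  have pos: "0 < sqrt (y + 2)" if "y \<in> conjugates n" for y
    using conjugates_bounds[OF that] by simp
  have "(\<lambda>y. sqrt (y + 2)) ` conjugates n \<inter> (\<lambda>y. - sqrt (y + 2)) ` conjugates n = {}"
  proof (intro equals0I, elim IntE imageE)
    fix x y z assume "y \<in> conjugates n" "z \<in> conjugates n" "x = sqrt (y + 2)" "x = - sqrt (z + 2)"
    then show False using pos[of y] pos[of z] by linarith
  qed
  moreover have "inj_on (\<lambda>y. sqrt (y + 2)) (conjugates n)"
    "inj_on (\<lambda>y. - sqrt (y + 2)) (conjugates n)"
    by (auto simp: inj_on_def)
  ultimately show ?thesis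
    by (simp add: conjugates.simps(2) prod.union_disjoint prod.reindex prod.distrib)
qed

text \<open>The product over the fibre above y is a(y)^2 - (y + 2) b(y)^2, again an integer
  polynomial in y. Descending to level 0 leaves the value of an integer polynomial at 0.\<close>

lemma prod_int_poly_fun_in_Ints:
  "int_poly_fun f \<Longrightarrow> prod f (conjugates n) \<in> \<int>"
proof (induction n arbitrary: f)
  case 0
  then show ?case by (induction rule: int_poly_fun.induct) auto
next
  case (Suc n)
  obtain a b where ab: "int_poly_fun a" "int_poly_fun b"
    "\<And>x. f x = a (x\<^sup>2 - 2) + x * b (x\<^sup>2 - 2)"
    using int_poly_fun_decompose[OF Suc.prems] by blast
  have "prod f (conjugates (Suc n)) = (\<Prod>y\<in>conjugates n. (a y)\<^sup>2 - (y + 2) * (b y)\<^sup>2)"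
    unfolding prod_conjugates_Suc
  proof (rule prod.cong)
    fix y assume "y \<in> conjugates n"
    then have "(sqrt (y + 2))\<^sup>2 = y + 2" using conjugates_bounds[of y n] by simp
    then show "f (sqrt (y + 2)) * f (- sqrt (y + 2)) = (a y)\<^sup>2 - (y + 2) * (b y)\<^sup>2"
      unfolding ab(3) by (simp add: algebra_simps power2_eq_square)
  qed simp
  also have "\<dots> \<in> \<int>" by (intro Suc.IH int_poly_fun_intros ab)
  finally show ?case .
qed

text \<open>The points s and -s above y contribute (2 - s)(2 + s) = 2 - y, so the norm descends
  unchanged to level 0.\<close>

lemma prod_conjugates_2_minus: "(\<Prod>y\<in>conjugates n. 2 - y) = 2"
proof (induction n)
  case (Suc n)
  have "(\<Prod>y\<in>conjugates (Suc n). 2 - y) = (\<Prod>y\<in>conjugates n. 2 - y)"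
    unfolding prod_conjugates_Suc
    by (rule prod.cong) (use conjugates_bounds[of _ n] in \<open>force simp: algebra_simps\<close>)+
  then show ?case using Suc by simp
qed simp

lemma prod_conjugates_plus_2: "(\<Prod>y\<in>conjugates n. y + 2) = 2"
proof (cases n)
  case (Suc k)
  have "(\<Prod>y\<in>conjugates (Suc k). y + 2) = (\<Prod>y\<in>conjugates k. 2 - y)"
    unfolding prod_conjugates_Suc
    by (rule prod.cong) (use conjugates_bounds[of _ k] in \<open>force simp: algebra_simps\<close>)+
  then show ?thesis using Suc prod_conjugates_2_minus by simp
qed simp

text \<open>Irrationality of the square root of 2: the 2-adic valuation would be even on the left
  and odd on the right.\<close>

lemma Ints_square_eq_twice_square:
  fixes A B :: real
  assumes "A \<in> \<int>" "B \<in> \<int>" "A\<^sup>2 = 2 * B\<^sup>2"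
  shows "B = 0"
proof (rule ccontr)
  assume B: "B \<noteq> 0"
  obtain a b :: int where ab: "A = of_int a" "B = of_int b"
    using assms(1,2) by (auto elim!: Ints_cases)
  have "of_int (a\<^sup>2) = (of_int (2 * b\<^sup>2) :: real)" using assms(3) ab by simp
  then have eq: "a\<^sup>2 = 2 * b\<^sup>2" by (simp only: of_int_eq_iff)
  have b: "b \<noteq> 0" using B ab by simp
  then have a: "a \<noteq> 0" using eq by auto
  have "2 * multiplicity 2 a = multiplicity 2 (a\<^sup>2)"
    using a by (simp add: prime_elem_multiplicity_power_distrib)
  also have "\<dots> = Suc (2 * multiplicity 2 b)"
    unfolding eq using b
    by (simp add: multiplicity_times_same prime_elem_multiplicity_power_distrib)
  finally show False by presburger
qed

text \<open>The norm \<open>2\<close> of \<open>y + 2\<close> is not a square, so \<open>y + 2\<close> is not a square in the field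
  generated by \<open>y\<close>; this replaces the irreducibility of the minimal polynomial.\<close>

lemma int_poly_fun_zero_on_conjugates:
  "\<lbrakk>int_poly_fun f; x \<in> conjugates n; f x = 0; z \<in> conjugates n\<rbrakk> \<Longrightarrow> f z = 0"
proof (induction n arbitrary: f x z)
  case (Suc n)
  obtain a b where ab: "int_poly_fun a" "int_poly_fun b"
    "\<And>x. f x = a (x\<^sup>2 - 2) + x * b (x\<^sup>2 - 2)"
    using int_poly_fun_decompose[OF Suc.prems(1)] by blast
  \<comment> \<open>f(x) = 0 means a(y) = -x b(y) at y = x^2 - 2. Squaring removes x and leaves an
    integer polynomial relation in y, which the induction hypothesis spreads to all conjugates
    below.\<close>
  have sq: "(a y)\<^sup>2 = (y + 2) * (b y)\<^sup>2" if "y \<in> conjugates n" for y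
  proof -
    have "int_poly_fun (\<lambda>y. (a y)\<^sup>2 - (y + 2) * (b y)\<^sup>2)" by (intro int_poly_fun_intros ab)
    moreover have "a (x\<^sup>2 - 2) = - (x * b (x\<^sup>2 - 2))" using Suc.prems(3) ab(3)[of x] by linarith
    then have "(a (x\<^sup>2 - 2))\<^sup>2 - ((x\<^sup>2 - 2) + 2) * (b (x\<^sup>2 - 2))\<^sup>2 = 0"
      by (simp add: power_mult_distrib)
    ultimately have "(a y)\<^sup>2 - (y + 2) * (b y)\<^sup>2 = 0"
      by (rule Suc.IH[OF _ conjugates_Suc_sq(1)[OF Suc.prems(2)] _ that])
    then show ?thesis by simp
  qed
  have "(prod a (conjugates n))\<^sup>2 = (\<Prod>y\<in>conjugates n. (y + 2) * (b y)\<^sup>2)"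
    unfolding prod_power_distrib using sq by (rule prod.cong[OF refl])
  also have "\<dots> = 2 * (prod b (conjugates n))\<^sup>2"
    by (simp only: prod.distrib prod_power_distrib prod_conjugates_plus_2)
  finally have "(prod a (conjugates n))\<^sup>2 = 2 * (prod b (conjugates n))\<^sup>2" .
  \<comment> \<open>The norms of \<open>a\<close> and \<open>b\<close> satisfy A^2 = 2 B^2 in the
    integers, so B = 0 and \<open>b\<close> vanishes at some conjugate. By induction it then
    vanishes at all of them, and so does \<open>a\<close>.\<close>
  then have "prod b (conjugates n) = 0"
    using Ints_square_eq_twice_square prod_int_poly_fun_in_Ints ab by blast
  then obtain y where "y \<in> conjugates n" "b y = 0" by auto
  then have "b w = 0" if "w \<in> conjugates n" for w
    using Suc.IH[OF ab(2) _ _ that] by blast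
  moreover have "a w = 0" if "w \<in> conjugates n" for w
    using sq[OF that] calculation[OF that] by simp
  ultimately show ?case
    using ab(3)[of z] conjugates_Suc_sq(1)[OF Suc.prems(4)] by simp
qed simp

section \<open>The tower of cosines and its units X_n + 1 and X_n - 1\<close>

lemma cosX_0 [simp]: "cosX 0 = 0"
  by (simp add: cosX_def)

text \<open>Half-angle formula; the angle is at most pi/2, which selects the nonnegative
  root.\<close>

lemma cosX_Suc: "cosX (Suc n) = sqrt (cosX n + 2)"
proof -
  let ?t = "2 * pi / 2 ^ (Suc n + 2)"
  have "2 * pi / 2 ^ (n + 2) = 2 * ?t" by simp
  then have "cosX n + 2 = (2 * cos ?t)\<^sup>2"
    unfolding cosX_def by (simp only: cos_double_cos) (simp add: power2_eq_square)
  moreover have "?t \<le> pi / 2"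
    using pi_gt_zero one_le_power[of "2::real" "Suc n"] by (simp add: field_simps)
  then have "0 \<le> cos ?t"
    by (intro cos_ge_zero) (auto intro: order_trans[of _ 0])
  ultimately show ?thesis unfolding cosX_def[of "Suc n"] by (simp only: real_sqrt_abs)
qed

lemma cosX_in_conjugates: "cosX n \<in> conjugates n"
  by (induction n) (auto simp: cosX_Suc conjugates.simps(2))

lemma cosX_Suc_sq: "(cosX (Suc n))\<^sup>2 = cosX n + 2"
  using conjugates_bounds[OF cosX_in_conjugates[of n]] by (simp add: cosX_Suc)

text \<open>Since (X_(n+1) - 1)(X_(n+1) + 1) = X_n + 1, an inverse of X_n + 1 times X_(n+1) - 1
  inverts X_(n+1) + 1. The recursion starts at X_0 + 1 = 1.\<close>

lemma ex_inverse_cosX_plus_1: "\<exists>g. int_poly_fun g \<and> g (cosX n) * (cosX n + 1) = 1"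
proof (induction n)
  case 0
  show ?case by (rule exI[of _ "\<lambda>_. 1"]) auto
next
  case (Suc n)
  then obtain g where g: "int_poly_fun g" "g (cosX n) * (cosX n + 1) = 1" by blast
  have "int_poly_fun (\<lambda>x. g (x\<^sup>2 - 2) * (x - 1))"
    by (intro int_poly_fun_compose[OF g(1)] int_poly_fun_intros)
  moreover have "(cosX (Suc n) - 1) * (cosX (Suc n) + 1) = cosX n + 1"
    using cosX_Suc_sq[of n] by (simp add: algebra_simps power2_eq_square)
  ultimately show ?case
    using g(2) cosX_Suc_sq[of n]
    by (intro exI[of _ "\<lambda>x. g (x\<^sup>2 - 2) * (x - 1)"]) (simp add: mult.assoc)
qed

lemma ex_inverse_cosX_minus_1: "\<exists>g. int_poly_fun g \<and> g (cosX (Suc n)) * (cosX (Suc n) - 1) = 1"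
proof -
  obtain g where g: "int_poly_fun g" "g (cosX n) * (cosX n + 1) = 1"
    using ex_inverse_cosX_plus_1 by blast
  have "int_poly_fun (\<lambda>x. g (x\<^sup>2 - 2) * (x + 1))"
    by (intro int_poly_fun_compose[OF g(1)] int_poly_fun_intros)
  moreover have "(cosX (Suc n) + 1) * (cosX (Suc n) - 1) = cosX n + 1"
    using cosX_Suc_sq[of n] by (simp add: algebra_simps power2_eq_square)
  ultimately show ?thesis
    using g(2) cosX_Suc_sq[of n]
    by (intro exI[of _ "\<lambda>x. g (x\<^sup>2 - 2) * (x + 1)"]) (simp add: mult.assoc)
qed

section \<open>Elements of relative norm 1\<close>

text \<open>A model of the relative norm kernel for n \<ge> 1 that mentions no automorphism: the
  nontrivial one over the field below sends X_n to -X_n, so f(X_n) f(-X_n) is the relative norm of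
  f(X_n).\<close>

definition rel_units :: "nat \<Rightarrow> real set" where
  "rel_units n = {z. \<exists>f. int_poly_fun f \<and> f (cosX n) = z \<and> f (cosX n) * f (- cosX n) = 1}"

lemma rel_units_mult: "y \<in> rel_units n \<Longrightarrow> z \<in> rel_units n \<Longrightarrow> y * z \<in> rel_units n"
proof -
  assume "y \<in> rel_units n" "z \<in> rel_units n"
  then obtain f g where fg: "int_poly_fun f" "int_poly_fun g" "f (cosX n) = y" "g (cosX n) = z"
    "f (cosX n) * f (- cosX n) = 1" "g (cosX n) * g (- cosX n) = 1"
    unfolding rel_units_def by blast
  have "(f (cosX n) * g (cosX n)) * (f (- cosX n) * g (- cosX n)) =
    (f (cosX n) * f (- cosX n)) * (g (cosX n) * g (- cosX n))" by simp
  also have "\<dots> = 1" using fg by simp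
  finally show ?thesis using fg unfolding rel_units_def
    by (intro CollectI exI[of _ "\<lambda>x. f x * g x"]) auto
qed

lemma rel_units_inverse: "z \<in> rel_units n \<Longrightarrow> inverse z \<in> rel_units n"
proof -
  assume "z \<in> rel_units n"
  then obtain f where f: "int_poly_fun f" "f (cosX n) = z" "f (cosX n) * f (- cosX n) = 1"
    unfolding rel_units_def by blast
  have "int_poly_fun (\<lambda>x. f (- x))" by (rule int_poly_fun_compose[OF f(1)]) auto
  moreover have "inverse z = f (- cosX n)" using f inverse_unique by metis
  ultimately show ?thesis using f(3) unfolding rel_units_def
    by (intro CollectI exI[of _ "\<lambda>x. f (- x)"]) (simp add: mult.commute)
qed

lemma rel_units_powi: "z \<in> rel_units n \<Longrightarrow> z powi k \<in> rel_units n"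
proof -
  assume z: "z \<in> rel_units n"
  have "1 \<in> rel_units n"
    unfolding rel_units_def by (intro CollectI exI[of _ "\<lambda>_. 1"]) auto
  then have "z ^ j \<in> rel_units n" for j
    by (induction j) (auto intro: rel_units_mult z)
  then show ?thesis
    by (auto simp: power_int_def power_inverse intro: rel_units_inverse)
qed

text \<open>Replacing X by -X turns (X + 1)/(X - 1) into its reciprocal. The polynomial is (x + 1)
  h(x), where h(X) inverts X - 1.\<close>

lemma eps_in_rel_units: "eps (Suc n) \<in> rel_units (Suc n)"
proof -
  let ?X = "cosX (Suc n)"
  obtain h where h: "int_poly_fun h" "h ?X * (?X - 1) = 1"
    using ex_inverse_cosX_minus_1 by blast
  \<comment> \<open>The relation h(x)(x - 1) = 1 passes from X to its conjugate -X.\<close>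
  have "int_poly_fun (\<lambda>x. h x * (x - 1) - 1)" by (intro int_poly_fun_intros h)
  then have h': "h (- ?X) * (- ?X - 1) - 1 = 0"
    using int_poly_fun_zero_on_conjugates[of "\<lambda>x. h x * (x - 1) - 1" ?X "Suc n" "- ?X"]
      cosX_in_conjugates uminus_conjugates_Suc h(2) by simp
  have "((?X + 1) * h ?X) * ((- ?X + 1) * h (- ?X)) = (h ?X * (?X - 1)) * (h (- ?X) * (- ?X - 1))"
    by (simp add: algebra_simps)
  also have "\<dots> = 1" using h(2) h' by simp
  finally have "((?X + 1) * h ?X) * ((- ?X + 1) * h (- ?X)) = 1" .
  moreover have "eps (Suc n) = (?X + 1) * h ?X"
    using h(2) unfolding eps_def by (cases "?X = 1") (simp_all add: field_simps)
  ultimately show ?thesis using h unfolding rel_units_def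
    by (intro CollectI exI[of _ "\<lambda>x. (x + 1) * h x"] conjI int_poly_fun_intros) auto
qed

section \<open>The size estimate and the absence of roots\<close>

text \<open>For D > 1 and m = 2 the difference of the two sides is (D - 1/D)(D - 1)^2/D > 0, and
  larger m only increases the right side. Any other d reduces to D = |d| or D = 1/|d|.\<close>

lemma abs_power_minus_inverse_gt:
  fixes d :: real
  assumes "2 \<le> m" "d \<noteq> 0" "\<bar>d\<bar> \<noteq> 1"
  shows "2 * \<bar>d - inverse d\<bar> < \<bar>d ^ m - inverse (d ^ m)\<bar>"
proof -
  have gt: "2 * \<bar>D - inverse D\<bar> < \<bar>D ^ m - inverse (D ^ m)\<bar>" if "1 < D" for D :: real
  proof -
    have "D * inverse D = 1" "0 < D - inverse D"
      using that by (auto simp: inverse_less_1_iff intro: less_trans[of _ 1])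
    have "0 < (D - inverse D) * ((D - 1)\<^sup>2 * inverse D)"
      using that \<open>0 < D - inverse D\<close> by simp
    also have "\<dots> = (D\<^sup>2 - inverse (D\<^sup>2)) - 2 * (D - inverse D)"
      using that by (simp add: field_simps power2_eq_square)
    finally have "2 * (D - inverse D) < D\<^sup>2 - inverse (D\<^sup>2)" by simp
    moreover have "D\<^sup>2 \<le> D ^ m" using that assms(1) by (intro power_increasing) auto
    moreover have "inverse (D ^ m) \<le> inverse (D\<^sup>2)"
      using calculation that by (intro le_imp_inverse_le) auto
    ultimately show ?thesis using \<open>0 < D - inverse D\<close> by linarith
  qed
  have sym: "\<bar>d ^ k - inverse (d ^ k)\<bar> = \<bar>\<bar>d\<bar> ^ k - inverse (\<bar>d\<bar> ^ k)\<bar>" for k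
    by (cases "d \<ge> 0"; cases "even k") (auto simp: power_minus_odd)
  show ?thesis
  proof (cases "\<bar>d\<bar> > 1")
    case True
    then show ?thesis using gt[of "\<bar>d\<bar>"] sym[of m] sym[of 1] by simp
  next
    case False
    then have "1 < inverse \<bar>d\<bar>" using assms by (simp add: one_less_inverse_iff)
    then show ?thesis using gt[of "inverse \<bar>d\<bar>"] sym[of m] sym[of 1]
      by (simp add: power_inverse abs_minus_commute)
  qed
qed

text \<open>|X + 1| = |X - 1| would force X = 0.\<close>

lemma abs_eps_neq_1: "\<bar>eps (Suc n)\<bar> \<noteq> 1" "eps (Suc n) \<noteq> 0"
proof -
  let ?X = "cosX (Suc n)"
  have X0: "?X \<noteq> 0" using conjugates_Suc_sq(2)[OF cosX_in_conjugates] .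
  have X1: "?X - 1 \<noteq> 0" using ex_inverse_cosX_minus_1[of n] by auto
  have X2: "?X + 1 \<noteq> 0" using ex_inverse_cosX_plus_1[of "Suc n"] by auto
  show "eps (Suc n) \<noteq> 0" using X1 X2 by (simp add: eps_def)
  show "\<bar>eps (Suc n)\<bar> \<noteq> 1"
  proof
    assume "\<bar>eps (Suc n)\<bar> = 1"
    then have "\<bar>?X + 1\<bar> = \<bar>?X - 1\<bar>" using X1 by (simp add: eps_def field_simps)
    then show False using X0 by linarith
  qed
qed

lemma eps_no_root_in_rel_units:
  assumes "2 \<le> m" "\<delta> \<in> rel_units (Suc n)"
  shows "\<delta> ^ m \<noteq> eps (Suc n)"
proof
  let ?X = "cosX (Suc n)" and ?R = "conjugates (Suc n)"
  assume root: "\<delta> ^ m = eps (Suc n)"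
  obtain f where f: "int_poly_fun f" "f ?X = \<delta>" "f ?X * f (- ?X) = 1"
    using assms(2) unfolding rel_units_def by blast
  obtain a b where ab: "int_poly_fun a" "int_poly_fun b"
    "\<And>x. f x = a (x\<^sup>2 - 2) + x * b (x\<^sup>2 - 2)"
    using int_poly_fun_decompose[OF f(1)] by blast
  obtain h where h: "int_poly_fun h" "h ?X * (?X - 1) = 1"
    using ex_inverse_cosX_minus_1 by blast
  have X1: "?X \<noteq> 1" using h(2) by auto
  let ?c = "\<lambda>x. (x\<^sup>2 - 1) * b (x\<^sup>2 - 2)"
  have c: "int_poly_fun ?c"
    by (intro int_poly_fun_compose[OF ab(2)] int_poly_fun_intros)
  have fm: "int_poly_fun (\<lambda>x. f (- x))" by (rule int_poly_fun_compose[OF f(1)]) auto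
  \<comment> \<open>The relations f(x) f(-x) = 1, h(x)(x - 1) = 1 and f(x)^m (x - 1) = x + 1 hold at
    X. Each is the vanishing of an integer polynomial, so each holds at every conjugate.\<close>
  have small: "\<bar>?c x\<bar> < 1" if x: "x \<in> ?R" for x
  proof -
    have "int_poly_fun (\<lambda>x. f x * f (- x) - 1)" by (intro int_poly_fun_intros f fm)
    then have "f x * f (- x) - 1 = 0"
      using int_poly_fun_zero_on_conjugates[of "\<lambda>x. f x * f (- x) - 1" ?X "Suc n" x]
        f(3) cosX_in_conjugates x by simp
    then have inv: "f (- x) = inverse (f x)" "f x \<noteq> 0"
      by (auto simp: inverse_unique)
    have "int_poly_fun (\<lambda>x. h x * (x - 1) - 1)" by (intro int_poly_fun_intros h)
    then have "h x * (x - 1) - 1 = 0"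
      using int_poly_fun_zero_on_conjugates[of "\<lambda>x. h x * (x - 1) - 1" ?X "Suc n" x]
        h(2) cosX_in_conjugates x by simp
    then have x1: "x - 1 \<noteq> 0" by auto
    have "int_poly_fun (\<lambda>x. f x ^ m * (x - 1) - (x + 1))" by (intro int_poly_fun_intros f)
    then have "f x ^ m * (x - 1) - (x + 1) = 0"
      using int_poly_fun_zero_on_conjugates[of "\<lambda>x. f x ^ m * (x - 1) - (x + 1)" ?X "Suc n" x]
        root f(2) X1 cosX_in_conjugates x by (simp add: eps_def)
    then have e: "f x ^ m = (x + 1) / (x - 1)" using x1 by (simp add: field_simps)
    then have x2: "x + 1 \<noteq> 0" using inv(2) by auto
    have x0: "x \<noteq> 0" using conjugates_Suc_sq(2) x by blast
    have "\<bar>f x\<bar> \<noteq> 1"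
    proof
      assume "\<bar>f x\<bar> = 1"
      then have "\<bar>f x ^ m\<bar> = 1" by (simp add: power_abs)
      then have "\<bar>x + 1\<bar> = \<bar>x - 1\<bar>" using e x1 by (simp add: field_simps)
      then show False using x0 by linarith
    qed
    \<comment> \<open>The left side becomes 4 |x b(x^2 - 2)| and the right side 4 |x| / |x^2 - 1|.
      Cancelling 4 |x| gives exactly the bound 1 for \<open>?c\<close>.\<close>
    from abs_power_minus_inverse_gt[OF assms(1) inv(2) this]
    have "2 * \<bar>f x - f (- x)\<bar> < \<bar>(x + 1) / (x - 1) - (x - 1) / (x + 1)\<bar>"
      unfolding e inv(1) by simp
    moreover have "(x + 1) / (x - 1) - (x - 1) / (x + 1) = 4 * x / (x\<^sup>2 - 1)"
      and q: "x\<^sup>2 - 1 \<noteq> 0"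
      using x1 x2 by (auto simp: field_simps power2_eq_square square_eq_1_iff)
    moreover have "f x - f (- x) = 2 * x * b (x\<^sup>2 - 2)"
      unfolding ab(3) by simp
    ultimately have "\<bar>x\<bar> * \<bar>b (x\<^sup>2 - 2)\<bar> < \<bar>x\<bar> * (1 / \<bar>x\<^sup>2 - 1\<bar>)"
      by (simp add: abs_mult)
    then have "\<bar>b (x\<^sup>2 - 2)\<bar> < 1 / \<bar>x\<^sup>2 - 1\<bar>"
      using x0 by (simp only: mult_less_cancel_left)
    then have "\<bar>x\<^sup>2 - 1\<bar> * \<bar>b (x\<^sup>2 - 2)\<bar> < 1" using q by (simp add: field_simps)
    then show ?thesis by (simp only: abs_mult)
  qed
  have "\<bar>prod ?c ?R\<bar> < 1"
  proof -
    \<comment> \<open>One factor is split off to keep the inequality strict, as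
      \<open>prod_le_1\<close> bounds the rest only by 1.\<close>
    have "(\<Prod>x\<in>?R. \<bar>?c x\<bar>) = \<bar>?c ?X\<bar> * (\<Prod>x\<in>?R - {?X}. \<bar>?c x\<bar>)"
      using cosX_in_conjugates by (intro prod.remove) auto
    also have "\<dots> \<le> \<bar>?c ?X\<bar> * 1"
      by (intro mult_left_mono prod_le_1) (use small in \<open>auto simp: less_imp_le\<close>)
    also have "\<dots> < 1" using small cosX_in_conjugates by simp
    finally show ?thesis by (simp only: abs_prod)
  qed
  then have "prod ?c ?R = 0"
    using prod_int_poly_fun_in_Ints[OF c] Ints_nonzero_abs_less1 by blast
  then obtain x where x: "x \<in> ?R" "?c x = 0" by auto
  then have "?c ?X = 0" using int_poly_fun_zero_on_conjugates[OF c] cosX_in_conjugates by blast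
  \<comment> \<open>X^2 - 1 = \<open>cosX n + 1\<close> is invertible, so the vanishing of
    \<open>?c\<close> at X comes from \<open>b\<close>. Then f(X) = f(-X), which is also the inverse
    of f(X).\<close>
  moreover obtain g where "g (cosX n) * (cosX n + 1) = 1"
    using ex_inverse_cosX_plus_1 by blast
  then have "cosX n + 1 \<noteq> 0" by auto
  then have "?X\<^sup>2 - 1 \<noteq> 0" unfolding cosX_Suc_sq by simp
  ultimately have "f ?X = f (- ?X)" using ab(3) by simp
  then have "\<delta>\<^sup>2 = 1" using f(2,3) by (simp add: power2_eq_square)
  then have "\<bar>\<delta>\<bar> = 1" by (auto simp: power2_eq_1_iff)
  then have "\<bar>eps (Suc n)\<bar> = 1" unfolding root[symmetric] by (simp add: power_abs)
  then show False using abs_eps_neq_1(1) by blast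
qed

section \<open>From rings and Galois groups to real arithmetic\<close>

lemma real_field_simps:
  "carrier real_field = UNIV" "x \<otimes>\<^bsub>real_field\<^esub> y = x * y" "x \<oplus>\<^bsub>real_field\<^esub> y = x + y"
  "\<one>\<^bsub>real_field\<^esub> = 1" "\<zero>\<^bsub>real_field\<^esub> = 0"
  by (simp_all add: ring_of_type_algebra_def)

lemma real_field_uminus: "\<ominus>\<^bsub>real_field\<^esub> x = - x"
proof -
  interpret ring real_field by rule
  show ?thesis
    by (rule minus_equality) (simp_all add: real_field_simps)
qed

lemma ZX_imp_int_poly_fun:
  assumes "z \<in> carrier (ZX n)"
  obtains f where "int_poly_fun f" "f (cosX n) = z"
proof -
  have "z \<in> generate_ring real_field {cosX n}" using assms by (simp add: ZX_def)
  then have "\<exists>f. int_poly_fun f \<and> f (cosX n) = z"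
  proof (induction rule: generate_ring.induct)
    case one
    show ?case by (intro exI[of _ "\<lambda>_. 1"]) (auto simp: real_field_simps)
  next
    case (incl h)
    then show ?case by (intro exI[of _ "\<lambda>x. x"]) auto
  next
    case (a_inv h)
    then obtain f where "int_poly_fun f" "f (cosX n) = h" by blast
    then show ?case
      by (intro exI[of _ "\<lambda>x. - f x"]) (auto simp: real_field_uminus)
  next
    case (eng_add h1 h2)
    then obtain f g where "int_poly_fun f" "f (cosX n) = h1" "int_poly_fun g" "g (cosX n) = h2"
      by blast
    then show ?case
      by (intro exI[of _ "\<lambda>x. f x + g x"]) (auto simp: real_field_simps)
  next
    case (eng_mult h1 h2)
    then obtain f g where "int_poly_fun f" "f (cosX n) = h1" "int_poly_fun g" "g (cosX n) = h2"
      by blast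
    then show ?case
      by (intro exI[of _ "\<lambda>x. f x * g x"]) (auto simp: real_field_simps)
  qed
  then show ?thesis using that by blast
qed

lemma in_carrier_B:
  shows cosX_in_B: "cosX n \<in> carrier (B n)"
    and one_in_B: "1 \<in> carrier (B n)"
    and add_in_B: "x \<in> carrier (B n) \<Longrightarrow> y \<in> carrier (B n) \<Longrightarrow> x + y \<in> carrier (B n)"
    and mult_in_B: "x \<in> carrier (B n) \<Longrightarrow> y \<in> carrier (B n) \<Longrightarrow> x * y \<in> carrier (B n)"
    and uminus_in_B: "x \<in> carrier (B n) \<Longrightarrow> - x \<in> carrier (B n)"
  using generate_field.incl[of "cosX n" "{cosX n}" real_field]
    generate_field.one[of real_field "{cosX n}"]
    generate_field.eng_add[of x real_field "{cosX n}" y]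
    generate_field.eng_mult[of x real_field "{cosX n}" y]
    generate_field.a_inv[of x real_field "{cosX n}"]
  by (simp_all add: B_def real_field_simps real_field_uminus)

text \<open>The part of being an automorphism of \<open>B n\<close> that the argument uses, stated
  with the operations of the reals.\<close>

definition B_hom :: "nat \<Rightarrow> (real \<Rightarrow> real) \<Rightarrow> bool" where
  "B_hom n h \<longleftrightarrow> h 1 = 1 \<and> h \<in> carrier (B n) \<rightarrow> carrier (B n) \<and>
    (\<forall>x\<in>carrier (B n). \<forall>y\<in>carrier (B n). h (x + y) = h x + h y \<and> h (x * y) = h x * h y)"

lemma int_poly_fun_in_B:
  assumes "int_poly_fun f"
  shows "f (cosX n) \<in> carrier (B n)"
proof -
  have nat: "of_nat k \<in> carrier (B n)" for k
  proof (induction k)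
    case 0
    show ?case using add_in_B[OF one_in_B uminus_in_B[OF one_in_B]] by simp
  qed (auto intro: add_in_B one_in_B)
  have "of_int k \<in> carrier (B n)" for k
    by (cases k rule: int_cases2) (auto intro: nat uminus_in_B)
  with assms show ?thesis
    by (induction rule: int_poly_fun.induct) (auto intro: add_in_B mult_in_B cosX_in_B)
qed

text \<open>Additivity and h(1) = 1 make h fix every integer; the rest is induction on the
  polynomial.\<close>

lemma B_hom_int_poly_fun:
  assumes "B_hom n h" "int_poly_fun f"
  shows "h (f (cosX n)) = f (h (cosX n))"
proof -
  note in_B = int_poly_fun_in_B[OF int_poly_fun.const, of _ n]
  have add: "h (x + y) = h x + h y" if "x \<in> carrier (B n)" "y \<in> carrier (B n)" for x y
    using assms(1) that by (simp add: B_hom_def)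
  have nat: "h (of_nat k) = of_nat k" for k
  proof (induction k)
    case 0
    show ?case using add[of 0 0] in_B[of 0] by simp
  next
    case (Suc k)
    then show ?case using add[of 1 "of_nat k"] in_B[of 1] in_B[of "int k"] assms(1)
      by (simp add: B_hom_def)
  qed
  have "h (of_int k) = of_int k" for k
  proof (cases k rule: int_cases2)
    case (nonpos j)
    then show ?thesis using add[of "of_int k" "of_int (- k)"] in_B[of k] in_B[of "- k"]
      nat[of j] nat[of 0] by simp
  qed (use nat in auto)
  with assms(2) show ?thesis
    by (induction rule: int_poly_fun.induct)
      (use assms(1) in \<open>auto simp: B_hom_def int_poly_fun_in_B\<close>)
qed

lemma G_carrier_B_hom:
  assumes "\<sigma> \<in> carrier (G n)"
  shows "\<sigma> \<in> Bij (carrier (B n))" "B_hom n \<sigma>"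
  using assms
  by (auto simp: G_def Galois_group_def Bij_def ring_iso_def ring_hom_def B_hom_def B_def
      real_field_simps)

text \<open>Multiplication in \<open>BijGroup\<close> is \<open>compose\<close> only on bijections,
  so membership in \<open>Bij\<close> is carried through the induction. The link to
  \<open>^^\<close> holds on the carrier, where \<open>compose\<close> agrees with
  composition.\<close>

lemma G_pow_B_hom:
  fixes k :: nat
  assumes "\<sigma> \<in> carrier (G n)"
  shows "\<sigma> [^]\<^bsub>G n\<^esub> k \<in> Bij (carrier (B n)) \<and> B_hom n (\<sigma> [^]\<^bsub>G n\<^esub> k) \<and>
    (\<forall>x\<in>carrier (B n). (\<sigma> [^]\<^bsub>G n\<^esub> k) x = (\<sigma> ^^ k) x)"
proof (induction k)
  case 0
  have "\<sigma> [^]\<^bsub>G n\<^esub> (0::nat) = (\<lambda>x\<in>carrier (B n). x)"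
    by (simp add: nat_pow_def G_def Galois_group_def BijGroup_def)
  then show ?case
    using id_Bij[of "carrier (B n)"]
    by (simp add: B_hom_def one_in_B add_in_B mult_in_B del: restrict_apply)
      (simp add: one_in_B add_in_B mult_in_B)
next
  case (Suc k)
  note s = G_carrier_B_hom[OF assms]
  have cl: "\<sigma> x \<in> carrier (B n)" if "x \<in> carrier (B n)" for x
    using s(2) that by (auto simp: B_hom_def)
  have eq: "\<sigma> [^]\<^bsub>G n\<^esub> Suc k = compose (carrier (B n)) (\<sigma> [^]\<^bsub>G n\<^esub> k) \<sigma>"
    using Suc s(1) by (simp add: nat_pow_def G_def Galois_group_def BijGroup_def)
  have "compose (carrier (B n)) (\<sigma> [^]\<^bsub>G n\<^esub> k) \<sigma> \<in> Bij (carrier (B n))"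
    using Suc s(1) by (blast intro: compose_Bij)
  moreover have "B_hom n (compose (carrier (B n)) (\<sigma> [^]\<^bsub>G n\<^esub> k) \<sigma>)"
    using Suc s(2) cl by (auto simp: B_hom_def compose_def one_in_B add_in_B mult_in_B Pi_iff)
  moreover have "\<forall>x\<in>carrier (B n).
    compose (carrier (B n)) (\<sigma> [^]\<^bsub>G n\<^esub> k) \<sigma> x = (\<sigma> ^^ Suc k) x"
    using Suc cl by (simp add: compose_eq funpow_Suc_right del: funpow.simps)
  ultimately show ?case unfolding eq by blast
qed

lemma cosX_in_B_le: "j \<le> n \<Longrightarrow> cosX j \<in> carrier (B n)"
proof -
  assume "j \<le> n"
  then have "\<exists>f. int_poly_fun f \<and> f (cosX n) = cosX j"
  proof (induction rule: inc_induct)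
    case base
    show ?case using int_poly_fun.ident by blast
  next
    case (step j)
    then obtain f where f: "int_poly_fun f" "f (cosX n) = cosX (Suc j)" by blast
    then show ?case using cosX_Suc_sq[of j]
      by (intro exI[of _ "\<lambda>x. (f x)\<^sup>2 - 2"] conjI int_poly_fun_intros) simp_all
  qed
  then show ?thesis using int_poly_fun_in_B by metis
qed

text \<open>The image is again a square root of X_j + 2, since h fixes X_j and 2.\<close>

lemma B_hom_cosX_Suc:
  assumes "B_hom n h" "Suc j \<le> n" "h (cosX j) = cosX j"
  shows "h (cosX (Suc j)) = cosX (Suc j) \<or> h (cosX (Suc j)) = - cosX (Suc j)"
proof -
  let ?X = "cosX (Suc j)"
  have B: "?X \<in> carrier (B n)" "cosX j \<in> carrier (B n)" "2 \<in> carrier (B n)"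
    using assms(2) cosX_in_B_le int_poly_fun_in_B[OF int_poly_fun_2] by auto
  have "(h ?X)\<^sup>2 = h (?X\<^sup>2)" using assms(1) B by (simp add: B_hom_def power2_eq_square)
  also have "\<dots> = h (cosX j) + h 2"
    unfolding cosX_Suc_sq using assms(1) B by (simp add: B_hom_def)
  also have "h 2 = 2" using B_hom_int_poly_fun[OF assms(1) int_poly_fun_2] .
  also have "h (cosX j) + 2 = ?X\<^sup>2" using assms(3) cosX_Suc_sq by simp
  finally show ?thesis by (simp add: power2_eq_iff)
qed

text \<open>If \<sigma> to the power 2^j fixes X_j, it sends X_(j+1) to itself or its negative.
  Either way its square, the power 2^(j+1), fixes X_(j+1).\<close>

lemma G_pow_fixes_cosX:
  assumes "\<sigma> \<in> carrier (G n)"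
  shows "j \<le> n \<Longrightarrow> (\<sigma> [^]\<^bsub>G n\<^esub> ((2::nat) ^ j)) (cosX j) = cosX j"
proof (induction j)
  case 0
  have "(\<sigma> [^]\<^bsub>G n\<^esub> (1::nat)) 0 = 0"
    using B_hom_int_poly_fun[OF _ int_poly_fun_0] G_pow_B_hom[OF assms] by blast
  then show ?case by simp
next
  case (Suc j)
  let ?h = "\<sigma> [^]\<^bsub>G n\<^esub> ((2::nat) ^ j)" and ?X = "cosX (Suc j)"
  have X: "?X \<in> carrier (B n)" using Suc.prems cosX_in_B_le by blast
  have h: "B_hom n ?h" "\<And>x. x \<in> carrier (B n) \<Longrightarrow> ?h x = (\<sigma> ^^ (2 ^ j)) x"
    using G_pow_B_hom[OF assms] by auto
  have hX: "?h ?X \<in> carrier (B n)" using h(1) X by (auto simp: B_hom_def)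
  have "(\<sigma> [^]\<^bsub>G n\<^esub> ((2::nat) ^ Suc j)) ?X = (\<sigma> ^^ (2 ^ j + 2 ^ j)) ?X"
    using G_pow_B_hom[OF assms] X by (simp add: mult_2)
  also have "\<dots> = ?h (?h ?X)" using h(2) X hX by (simp add: funpow_add)
  also have "\<dots> = ?X"
  proof -
    have "?h (- y) = - ?h y" if "y \<in> carrier (B n)" for y
    proof -
      have "?h (- 1 * y) = ?h (- 1) * ?h y"
        using h(1) that uminus_in_B[OF one_in_B] by (simp only: B_hom_def)
      then show ?thesis
        using B_hom_int_poly_fun[OF h(1) int_poly_fun.const[of "- 1"]] by simp
    qed
    then show ?thesis
      using B_hom_cosX_Suc[OF h(1) Suc.prems] Suc X by auto
  qed
  finally show ?case .
qed

text \<open>With \<delta> = f(X), norm 1 reads f(X) f(h(X)) = 1, where h is the automorphism in the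
  norm. The two cases are h(X) = X and h(X) = -X.\<close>

lemma RE_plus_cases:
  assumes "\<sigma> \<in> carrier (G (Suc n))" "\<delta> \<in> RE_plus (Suc n) \<sigma>"
  shows "\<delta>\<^sup>2 = 1 \<or> \<delta> \<in> rel_units (Suc n)"
proof -
  let ?h = "\<sigma> [^]\<^bsub>G (Suc n)\<^esub> ((2::nat) ^ n)" and ?X = "cosX (Suc n)"
  have d: "\<delta> \<in> carrier (ZX (Suc n))" "\<delta> * ?h \<delta> = 1"
    using assms(2)
    by (auto simp: RE_plus_def kernel_def E_def units_of_def Units_def rel_norm_def ZX_def
        real_field_simps)
  obtain f where f: "int_poly_fun f" "f ?X = \<delta>" using ZX_imp_int_poly_fun[OF d(1)] .
  have h: "B_hom (Suc n) ?h" using G_pow_B_hom[OF assms(1)] by blast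
  have "?h \<delta> = f (?h ?X)" using B_hom_int_poly_fun[OF h f(1)] f(2) by simp
  moreover have "?h ?X = ?X \<or> ?h ?X = - ?X"
    using B_hom_cosX_Suc[OF h] G_pow_fixes_cosX[OF assms(1)] by simp
  ultimately show ?thesis
    using d(2) f unfolding rel_units_def by (auto simp: power2_eq_square)
qed

section \<open>Reduction of the exponent l/m to 1/m\<close>

theorem theorem3p9:
  fixes n :: nat and l m :: int and \<sigma> :: "real \<Rightarrow> real"
  assumes "n \<ge> 1"
    and "\<sigma> \<in> carrier (G n)"
    and "generate (G n) {\<sigma>} = carrier (G n)"
    and "m \<ge> 1"
    and "gcd l m = 1"
    and "0 < \<bar>real_of_int l / real_of_int m\<bar>"
    and "\<bar>real_of_int l / real_of_int m\<bar> < 1"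
  shows "\<not> (\<exists>\<delta> \<in> RE_plus n \<sigma>. \<delta> powi m = eps n powi l)"
proof
  assume "\<exists>\<delta> \<in> RE_plus n \<sigma>. \<delta> powi m = eps n powi l"
  then obtain \<delta> where d: "\<delta> \<in> RE_plus n \<sigma>" "\<delta> powi m = eps n powi l" by blast
  obtain k where n: "n = Suc k" using assms(1) by (cases n) auto
  note e = abs_eps_neq_1[of k, folded n]
  have l0: "l \<noteq> 0" using assms(6) by auto
  have "real_of_int \<bar>l\<bar> < real_of_int m" using assms(4,7) by (simp add: abs_divide field_simps)
  then have m2: "2 \<le> m" using l0 by linarith
  \<comment> \<open>Otherwise |eps|^|l| = 1 with l nonzero, contrary to |eps| \<noteq> 1.\<close>
  have "\<delta>\<^sup>2 \<noteq> 1"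
  proof
    assume "\<delta>\<^sup>2 = 1"
    then have "\<bar>\<delta>\<bar> = 1" by (auto simp: power2_eq_1_iff)
    then have "\<bar>eps n powi l\<bar> = 1" unfolding d(2)[symmetric] by (simp add: power_int_abs)
    then have "\<bar>eps n\<bar> ^ nat \<bar>l\<bar> = 1" using e(2)
      by (auto simp: power_int_def power_abs power_inverse abs_inverse split: if_splits)
    then show False using l0 e(1) power_eq_1_iff[of "\<bar>eps n\<bar>" "nat \<bar>l\<bar>"] by auto
  qed
  then have d_units: "\<delta> \<in> rel_units n" using RE_plus_cases assms(2) d(1) n by blast
  \<comment> \<open>From u l + v m = 1 the element \<delta>^u eps^v has m-th power eps^(u l + v m) =
    eps, and it still has relative norm 1.\<close>
  obtain u v where uv: "u * l + v * m = 1" using bezout_int[of l m] assms(5) by auto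
  let ?\<eta> = "\<delta> powi u * eps n powi v"
  have "?\<eta> ^ nat m = ?\<eta> powi m" using assms(4) by (simp add: power_int_def)
  also have "\<dots> = (\<delta> powi m) powi u * eps n powi (v * m)"
    by (simp add: power_int_mult_distrib mult.commute flip: power_int_mult)
  also have "\<dots> = eps n powi (u * l + v * m)"
    unfolding d(2) using e(2) by (simp add: power_int_add mult.commute flip: power_int_mult)
  also have "\<dots> = eps n" using uv by simp
  finally have "?\<eta> ^ nat m = eps n" .
  moreover have "?\<eta> \<in> rel_units n"
    using d_units eps_in_rel_units n by (auto intro: rel_units_mult rel_units_powi)
  ultimately show False using eps_no_root_in_rel_units[of "nat m" ?\<eta> k] m2 n
    by (simp add: le_nat_iff)
qed

end
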